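(* For any fixed parameters $q, z, r \in \mathbb{C}$ with $q \neq 0$, the exponential square series functions $$E_{\mathrm{sq}}(q, r, z) := \sum_{n=0}^{\infty} q^{n^2} r^n \frac{z^n}{n!}, \qquad \widetilde{E}_{\mathrm{sq}}(q, r, z) := \sum_{n=0}^{\infty} q^{\binom{n}{2}} r^n \frac{z^n}{n!}$$ have the following integral representations: $$E_{\mathrm{sq}}(q, r, z) = \int_0^{\infty} \frac{e^{-t^2/2}}{\sqrt{2\pi}} \left[ \exp\left(e^{\sqrt{2 \operatorname{Log}(q)}\, t}\, rz\right) + \exp\left(e^{-\sqrt{2 \operatorname{Log}(q)}\, t}\, rz\right) \right] dt,$$ $$\widetilde{E}_{\mathrm{sq}}(q, r, z) = \int_0^{\infty} \frac{e^{-t^2/2}}{\sqrt{2\pi}} \left[ \exp\left(e^{\sqrt{\operatorname{Log}(q)}\, t}\, \frac{rz}{\sqrt{q}}\right) + \exp\left(e^{-\sqrt{\operatorname{Log}(q)}\, t}\, \frac{rz}{\sqrt{q}}\right) \right] dt.$$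
   Context: $\operatorname{Log}$ is the principal logarithm and $\sqrt{q} = \exp(\tfrac12 \operatorname{Log}(q))$; the choice of the square roots $\sqrt{2\operatorname{Log}(q)}$ and $\sqrt{\operatorname{Log}(q)}$ does not matter, since both signs appear. The paper states that its approach to these expansions mostly follows from results justified as operations on formal power series, and notes that the integrands here can be integrated termwise in $z$.
   Formalization: For general q ≠ 0 the series or the integral may diverge (e.g. q = 2, r = z = 1), so the identities are proved termwise as formal power series in z for all q ≠ 0, and numerically whenever both sides converge (absolutely for the integral), which includes all r, z when 0 < q ≤ 1. *)

theory Defs
  imports "HOL-Analysis.Analysis"
begin

definition E_sq :: "complex \<Rightarrow> complex \<Rightarrow> complex \<Rightarrow> complex" where
  "E_sq q r z = (\<Sum>n. q ^ (n\<^sup>2) * r ^ n * (z ^ n / fact n))"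

definition E_sq_tilde :: "complex \<Rightarrow> complex \<Rightarrow> complex \<Rightarrow> complex" where
  "E_sq_tilde q r z = (\<Sum>n. q ^ (n choose 2) * r ^ n * (z ^ n / fact n))"

text \<open>
  For \<open>r * z \<noteq> 0\<close> the two series above converge only if \<open>norm q \<le> 1\<close>, and among these \<open>q\<close>
  the integrals that represent them converge only for \<open>q \<in> {0<..1}\<close>. For general \<open>q \<noteq> 0\<close>
  the functions are therefore the formal power series below in \<open>z\<close>, and integrals are taken
  termwise in \<open>z\<close>.
\<close>

definition E_sq_fps :: "complex \<Rightarrow> complex \<Rightarrow> complex fps" where
  "E_sq_fps q r = Abs_fps (\<lambda>n. q ^ (n\<^sup>2) * r ^ n / fact n)"

definition E_sq_tilde_fps :: "complex \<Rightarrow> complex \<Rightarrow> complex fps" where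
  "E_sq_tilde_fps q r = Abs_fps (\<lambda>n. q ^ (n choose 2) * r ^ n / fact n)"

definition has_termwise_integral :: "(real \<Rightarrow> complex fps) \<Rightarrow> complex fps \<Rightarrow> real set \<Rightarrow> bool" where
  "has_termwise_integral F G A \<longleftrightarrow>
     (\<forall>n. set_integrable lborel A (\<lambda>t. fps_nth (F t) n) \<and>
          (LBINT t:A. fps_nth (F t) n) = fps_nth G n)"

definition gauss_weight :: "real \<Rightarrow> complex" where
  "gauss_weight t = of_real (exp (- (t\<^sup>2) / 2) / sqrt (2 * pi))"

definition sq_integrand :: "complex \<Rightarrow> complex \<Rightarrow> real \<Rightarrow> complex" where
  "sq_integrand s w t =
     gauss_weight t * (exp (exp (s * of_real t) * w) + exp (exp (- s * of_real t) * w))"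

text \<open>
  The integrand for \<open>w = c * z\<close> as a formal power series in \<open>z\<close>; \<open>fps_exp a\<close> is the
  expansion of \<open>exp (a * z)\<close>.
\<close>

definition sq_integrand_fps :: "complex \<Rightarrow> complex \<Rightarrow> real \<Rightarrow> complex fps" where
  "sq_integrand_fps s c t =
     fps_const (gauss_weight t) *
       (fps_exp (exp (s * of_real t) * c) + fps_exp (exp (- s * of_real t) * c))"

lemma eval_E_sq_fps: "eval_fps (E_sq_fps q r) z = E_sq q r z"
  by (simp add: eval_fps_def E_sq_fps_def E_sq_def)

lemma eval_E_sq_tilde_fps: "eval_fps (E_sq_tilde_fps q r) z = E_sq_tilde q r z"
  by (simp add: eval_fps_def E_sq_tilde_fps_def E_sq_tilde_def)

lemma eval_sq_integrand_fps: "eval_fps (sq_integrand_fps s c t) z = sq_integrand s (c * z) t"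
proof -
  let ?a = "fps_exp (exp (s * of_real t) * c)" and ?b = "fps_exp (exp (- s * of_real t) * c)"
  have "fps_conv_radius (?a + ?b) = \<infinity>"
    using fps_conv_radius_add[of ?a ?b] by simp
  then show ?thesis
    unfolding sq_integrand_fps_def sq_integrand_def
    by (simp add: eval_fps_mult eval_fps_add mult.assoc)
qed

end

theory Submission
  imports Defs "HOL-Probability.Probability" "HOL-Real_Asymp.Real_Asymp"
begin

text \<open>
  A Gaussian variable \<open>T\<close> has the exponential moments \<open>E (exp (c * T)) = exp (c\<^sup>2 / 2)\<close>, for every
  complex \<open>c\<close>. With \<open>c = n * s\<close> this is \<open>p ^ (n\<^sup>2)\<close> where \<open>p = exp (s\<^sup>2 / 2)\<close>: the square in the
  exponent of the series comes from the square in the moment formula. Adding the integrands at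
  \<open>s\<close> and \<open>- s\<close> folds the integral over the real line onto the half-line. This gives both
  coefficientwise identities at once: the first family is \<open>p = q\<close> with argument \<open>r * z\<close>, and the
  second is \<open>p = exp (Ln q / 2)\<close> with argument \<open>r * z / p\<close>, because \<open>n\<^sup>2 - n = 2 * (n choose 2)\<close>.

  For the functions themselves, write \<open>w\<close> for the argument. If \<open>s\<close> is purely imaginary or
  \<open>w = 0\<close>, the \<open>n\<close>-th term of the integrand is at most the Gaussian density times
  \<open>2 * norm w ^ n / n!\<close>, so series and integral may be interchanged
  (lemma \<open>sq_integrand_termwise\<close>). This covers \<open>q \<in> {0<..1}\<close>, where \<open>Ln q\<close> is a nonpositive real.
  When the series and the integral both converge and \<open>w \<noteq> 0\<close>, \<open>s\<close> is necessarily imaginary: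
  convergence of the series forces \<open>norm p \<le> 1\<close>, that is \<open>(Re s)\<^sup>2 \<le> (Im s)\<^sup>2\<close>, while the integral
  diverges as soon as \<open>Re s\<close> and \<open>Im s\<close> are both nonzero
  (lemma \<open>sq_integrand_not_integrable_pos\<close>).
\<close>

section \<open>Exponential moments of the standard normal distribution\<close>

lemma gauss_weight_std_normal: "gauss_weight t = of_real (std_normal_density t)"
  by (simp add: gauss_weight_def std_normal_density_def)

lemma gauss_weight_measurable [measurable]: "gauss_weight \<in> borel_measurable borel"
  by (simp add: gauss_weight_std_normal[abs_def])

lemma norm_gauss_weight: "norm (gauss_weight t) = std_normal_density t"
  by (simp add: gauss_weight_std_normal)

lemma gauss_weight_minus: "gauss_weight (- t) = gauss_weight t"
  by (simp add: gauss_weight_def)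

text \<open>
  Completing the square in the real part \<open>a\<close> of \<open>c\<close> turns the integrand into a translate by \<open>a\<close>
  of the integrand for \<open>\<i> * Im c\<close>, up to a constant factor; what remains is the characteristic
  function of the standard normal distribution.
\<close>

lemma has_bochner_integral_gauss_exp:
  fixes c :: complex
  shows "has_bochner_integral lborel (\<lambda>t. gauss_weight t * exp (c * of_real t)) (exp (c\<^sup>2 / 2))"
proof -
  define a b where "a = Re c" and "b = Im c"
  have c: "c = of_real a + \<i> * of_real b"
    by (simp add: a_def b_def complex_eq_iff)
  define f where "f x = gauss_weight x * exp (\<i> * of_real (b * x))" for x
  define K where "K = exp (of_real (a\<^sup>2 / 2) + \<i> * of_real (a * b))"
  have meas [measurable]: "f \<in> borel_measurable borel"
    unfolding f_def by measurable
  have int: "integrable lborel f"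
  proof (rule Bochner_Integration.integrable_bound)
    show "integrable lborel std_normal_density" by simp
    show "AE x in lborel. norm (f x) \<le> norm (std_normal_density x)"
      by (simp add: f_def norm_mult norm_gauss_weight del: of_real_mult)
  qed simp
  have "integral\<^sup>L lborel f = char std_normal_distribution b"
    unfolding char_def
    by (subst integral_density)
       (auto simp: f_def gauss_weight_std_normal scaleR_conv_of_real
          intro!: Bochner_Integration.integral_cong)
  also have "\<dots> = exp (of_real (- (b\<^sup>2) / 2))"
    by (simp only: char_std_normal_distribution exp_of_real)
  finally have "has_bochner_integral lborel f (exp (of_real (- (b\<^sup>2) / 2)))"
    using int by (simp add: has_bochner_integral_iff)
  then have "has_bochner_integral lborel (\<lambda>t. f (- a + 1 * t)) (exp (of_real (- (b\<^sup>2) / 2)))"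
    by (subst (asm) lborel_has_bochner_integral_real_affine_iff[of 1 _ _ "- a"]) simp_all
  then have "has_bochner_integral lborel (\<lambda>t. K * f (- a + 1 * t))
      (K * exp (of_real (- (b\<^sup>2) / 2)))"
    by (rule has_bochner_integral_mult_right)
  moreover have "K * f (- a + 1 * t) = gauss_weight t * exp (c * of_real t)" for t
  proof -
    have shift: "- a + 1 * t = t - a" by simp
    have "K * f (- a + 1 * t) = exp (of_real (a\<^sup>2 / 2) + \<i> * of_real (a * b)
        + of_real (- ((t - a)\<^sup>2) / 2) + \<i> * of_real (b * (t - a))) / of_real (sqrt (2 * pi))"
      by (simp only: K_def f_def gauss_weight_def exp_add of_real_divide exp_of_real [symmetric]
            shift) simp
    also have "of_real (a\<^sup>2 / 2) + \<i> * of_real (a * b) + of_real (- ((t - a)\<^sup>2) / 2)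
        + \<i> * of_real (b * (t - a)) = of_real (- (t\<^sup>2) / 2) + c * of_real t"
      by (simp add: c complex_eq_iff power2_eq_square field_simps)
    finally show ?thesis
      by (simp only: gauss_weight_def exp_add of_real_divide exp_of_real [symmetric]) simp
  qed
  moreover have "K * exp (of_real (- (b\<^sup>2) / 2)) = exp (c\<^sup>2 / 2)"
  proof -
    have "of_real (a\<^sup>2 / 2) + \<i> * of_real (a * b) + of_real (- (b\<^sup>2) / 2) = c\<^sup>2 / 2"
      by (simp add: c complex_eq_iff power2_eq_square field_simps)
    then show ?thesis
      by (simp only: K_def exp_add [symmetric])
  qed
  ultimately show ?thesis by simp
qed

lemma half_line_integral_symmetrized:
  fixes f :: "real \<Rightarrow> 'a :: {banach, second_countable_topology}"
  assumes "has_bochner_integral lborel f I"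
  shows "set_integrable lborel {0..} (\<lambda>t. f t + f (- t))"
    and "(LBINT t:{0..}. f t + f (- t)) = I"
proof -
  have f: "integrable lborel f" "integral\<^sup>L lborel f = I"
    using assms by (simp_all add: has_bochner_integral_iff)
  have g: "integrable lborel (\<lambda>t. f (- t))"
    using lborel_integrable_real_affine[OF f(1), of "-1" 0] by simp
  have si: "set_integrable lborel A f" "set_integrable lborel A (\<lambda>t. f (- t))"
    if "A \<in> sets borel" for A
    using f(1) g that by (auto simp: set_integrable_def intro!: integrable_mult_indicator)
  show "set_integrable lborel {0..} (\<lambda>t. f t + f (- t))"
    using si by (intro set_integral_add) auto
  have "(LBINT t:{0..}. f t + f (- t)) = (LBINT t:{0..}. f t) + (LBINT t:{0..}. f (- t))"
    using si by (intro set_integral_add) auto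
  also have "(LBINT t:{0..}. f (- t)) = (LBINT t:{..0}. f t)"
    by (subst set_integral_reflect) (simp add: atMost_def)
  also have "(LBINT t:{0..}. f t) + (LBINT t:{..0}. f t) = (LBINT t:{0..} \<union> {..0}. f t)"
  proof (rule set_integral_Un_AE [symmetric])
    have "AE x in lborel. x \<noteq> (0 :: real)"
      by (rule AE_lborel_singleton)
    then show "AE x in lborel. \<not> (x \<in> {0..} \<and> x \<in> {..(0 :: real)})"
      by eventually_elim auto
  qed (use si in auto)
  also have "{0..} \<union> {..0} = (UNIV :: real set)" by auto
  finally show "(LBINT t:{0..}. f t + f (- t)) = I"
    using f by (simp add: set_lebesgue_integral_def)
qed

text \<open>
  The second summand is the first one at \<open>- t\<close>, which is the shape that
  \<open>half_line_integral_symmetrized\<close> expects.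
\<close>

lemma sq_integrand_fps_nth:
  "fps_nth (sq_integrand_fps s c t) n =
     gauss_weight t * exp (of_nat n * s * of_real t) * (c ^ n / fact n) +
     gauss_weight (- t) * exp (of_nat n * s * of_real (- t)) * (c ^ n / fact n)"
  by (simp add: sq_integrand_fps_def gauss_weight_minus power_mult_distrib
        exp_of_nat_mult [symmetric] field_simps)

lemma has_termwise_integral_sq_integrand_fps:
  "has_termwise_integral (sq_integrand_fps s c)
     (Abs_fps (\<lambda>n. exp (s\<^sup>2 / 2) ^ (n\<^sup>2) * c ^ n / fact n)) {0..}"
proof -
  have "set_integrable lborel {0..} (\<lambda>t. fps_nth (sq_integrand_fps s c t) n) \<and>
    (LBINT t:{0..}. fps_nth (sq_integrand_fps s c t) n) =
      exp (s\<^sup>2 / 2) ^ (n\<^sup>2) * (c ^ n / fact n)" for n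
  proof -
    have "has_bochner_integral lborel
        (\<lambda>t. gauss_weight t * exp (of_nat n * s * of_real t) * (c ^ n / fact n))
        (exp ((of_nat n * s)\<^sup>2 / 2) * (c ^ n / fact n))"
      by (intro has_bochner_integral_mult_left has_bochner_integral_gauss_exp)
    moreover have "exp ((of_nat n * s)\<^sup>2 / 2) = exp (s\<^sup>2 / 2) ^ (n\<^sup>2)"
      by (simp add: exp_of_nat_mult [symmetric] power_mult_distrib)
    ultimately have "has_bochner_integral lborel
        (\<lambda>t. gauss_weight t * exp (of_nat n * s * of_real t) * (c ^ n / fact n))
        (exp (s\<^sup>2 / 2) ^ (n\<^sup>2) * (c ^ n / fact n))"
      by simp
    from half_line_integral_symmetrized[OF this] show ?thesis
      unfolding sq_integrand_fps_nth by blast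
  qed
  then show ?thesis
    by (simp add: has_termwise_integral_def)
qed

section \<open>Imaginary exponent: termwise integration of the actual function\<close>

text \<open>
  Under the hypothesis, \<open>norm (exp (n * s * t) * w ^ n) \<le> norm w ^ n\<close>: the exponential has modulus 1
  if \<open>s\<close> is imaginary, and if \<open>w = 0\<close> only the constant term survives. The norms are thus
  dominated by the Gaussian density times the terms of an exponential series, and the series
  of integrals converges absolutely.
\<close>

lemma sq_integrand_termwise:
  assumes "w = 0 \<or> Re s = 0"
  shows "set_integrable lborel {0..} (sq_integrand s w)"
    and "(\<lambda>n. exp (s\<^sup>2 / 2) ^ (n\<^sup>2) * w ^ n / fact n) sums (LBINT t:{0..}. sq_integrand s w t)"
proof -
  define F where "F = (\<lambda>n t. indicator {0..} t *\<^sub>R fps_nth (sq_integrand_fps s w t) n)"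
  have F: "integrable lborel (F n)"
      "integral\<^sup>L lborel (F n) = exp (s\<^sup>2 / 2) ^ (n\<^sup>2) * w ^ n / fact n" for n
    using has_termwise_integral_sq_integrand_fps[of s w]
    by (auto simp: has_termwise_integral_def set_integrable_def set_lebesgue_integral_def F_def)
  define B where "B n t = 2 * std_normal_density t * (norm w ^ n / fact n)" for n t
  have bound: "norm (F n t) \<le> B n t" for n t
  proof -
    have e: "norm (exp (of_nat n * s * of_real x) * w ^ n) \<le> norm w ^ n" for x
      using assms by (cases n) (auto simp: norm_mult norm_power)
    have "norm (gauss_weight x * exp (of_nat n * s * of_real x) * (w ^ n / fact n))
        \<le> std_normal_density x * (norm w ^ n / fact n)" for x
      using mult_left_mono[OF divide_right_mono[OF e, of "fact n"], of "std_normal_density x"]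
      by (simp add: norm_mult norm_divide norm_gauss_weight norm_power mult.assoc)
    from this[of t] this[of "- t"]
    have "norm (fps_nth (sq_integrand_fps s w t) n) \<le> B n t"
      unfolding sq_integrand_fps_nth
      by (intro order.trans[OF norm_triangle_ineq]) (simp add: B_def std_normal_density_def)
    moreover have "B n t \<ge> 0" by (simp add: B_def)
    ultimately show ?thesis
      by (simp add: F_def indicator_def)
  qed
  have exp_sum: "summable (\<lambda>n. norm w ^ n / fact n)"
    using summable_exp_generic[of "norm w"] by (simp add: field_simps)
  have pointwise: "summable (\<lambda>n. norm (F n t))" for t
  proof (rule summable_comparison_test)
    show "\<exists>N. \<forall>n\<ge>N. norm (norm (F n t)) \<le> B n t" using bound by auto
    show "summable (\<lambda>n. B n t)" unfolding B_def by (intro summable_mult exp_sum)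
  qed
  have norms: "summable (\<lambda>n. LINT t|lborel. norm (F n t))"
  proof (rule summable_comparison_test)
    have "(LINT t|lborel. norm (F n t)) \<le> 2 * (norm w ^ n / fact n)" for n
    proof -
      have "(LINT t|lborel. norm (F n t)) \<le> (LINT t|lborel. B n t)"
        using F bound by (intro integral_mono) (auto simp: B_def)
      also have "\<dots> = 2 * (norm w ^ n / fact n)"
        by (simp add: B_def)
      finally show ?thesis .
    qed
    then show "\<exists>N. \<forall>n\<ge>N. norm (LINT t|lborel. norm (F n t)) \<le> 2 * (norm w ^ n / fact n)"
      by simp
    show "summable (\<lambda>n. 2 * (norm w ^ n / fact n))" by (intro summable_mult exp_sum)
  qed
  have total: "(\<Sum>n. F n t) = indicator {0..} t *\<^sub>R sq_integrand s w t" for t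
  proof -
    \<comment> \<open>The power series in \<open>z\<close> with parameter \<open>w\<close>, evaluated at \<open>z = 1\<close>.\<close>
    have "sq_integrand s w t = (\<Sum>n. fps_nth (sq_integrand_fps s w t) n)"
      using eval_sq_integrand_fps[of s w t 1] by (simp add: eval_fps_def)
    then show ?thesis by (simp add: F_def indicator_def)
  qed
  show "set_integrable lborel {0..} (sq_integrand s w)"
    using integrable_suminf[OF F(1) AE_I2[OF pointwise] norms]
    by (simp add: set_integrable_def total)
  show "(\<lambda>n. exp (s\<^sup>2 / 2) ^ (n\<^sup>2) * w ^ n / fact n) sums (LBINT t:{0..}. sq_integrand s w t)"
    using sums_integral[OF F(1) AE_I2[OF pointwise] norms]
    by (simp add: set_lebesgue_integral_def total F(2))
qed

section \<open>Where the series and the integral diverge\<close>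

text \<open>
  Consecutive terms have the ratio \<open>p ^ (2 * n + 1) * w / (n + 1)\<close>. If \<open>norm p > 1\<close> it tends to
  infinity in modulus, so the terms eventually grow and cannot tend to 0.
\<close>

lemma norm_le_1_if_summable_square_powers:
  fixes p w :: complex
  assumes "summable (\<lambda>n. p ^ (n\<^sup>2) * w ^ n / fact n)" and "w \<noteq> 0"
  shows "norm p \<le> 1"
proof (rule ccontr)
  define a where "a n = norm (p ^ (n\<^sup>2) * w ^ n / fact n)" for n
  define P W where "P = norm p" and "W = norm w"
  assume "\<not> norm p \<le> 1"
  then have P: "P > 1" and W: "W > 0"
    using assms by (auto simp: P_def W_def)
  have "filterlim (\<lambda>n. P ^ (2 * n + 1) * W / real (Suc n)) at_top sequentially"
    using P W by real_asymp
  then have "eventually (\<lambda>n. P ^ (2 * n + 1) * W / real (Suc n) \<ge> 1) sequentially"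
    unfolding filterlim_at_top by (rule spec)
  then obtain N where N: "\<And>n. n \<ge> N \<Longrightarrow> P ^ (2 * n + 1) * W / real (Suc n) \<ge> 1"
    by (auto simp: eventually_sequentially)
  have ratio: "a (Suc n) = a n * (P ^ (2 * n + 1) * W / real (Suc n))" for n
  proof -
    have "(Suc n)\<^sup>2 = n\<^sup>2 + (2 * n + 1)" by (simp add: power2_eq_square)
    then show ?thesis
      unfolding a_def P_def W_def
      by (simp only: power_add norm_mult norm_divide norm_power fact_Suc power_Suc [of w]
            of_nat_mult norm_of_nat) (simp add: mult_ac)
  qed
  have "a N \<le> a n" if "n \<ge> N" for n
    using that
  proof (induction rule: dec_induct)
    case (step n)
    have "a n * 1 \<le> a (Suc n)"
      unfolding ratio by (intro mult_left_mono N step) (simp add: a_def)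
    with step show ?case by simp
  qed simp
  moreover have "a \<longlonglongrightarrow> 0"
    unfolding a_def using summable_LIMSEQ_zero[OF assms(1)] by (rule tendsto_norm_zero)
  ultimately have "a N \<le> 0"
    by (intro tendsto_lowerbound[of a 0 sequentially "a N"])
       (auto simp: eventually_sequentially)
  moreover have "a N > 0"
    using P W by (auto simp: a_def P_def W_def)
  ultimately show False by simp
qed

text \<open>
  Let \<open>S\<close> be the part of a periodic open set \<open>C\<close> above a threshold. Translating by a period \<open>P\<close>
  shows that \<open>S\<close> has the same measure as the part of \<open>C\<close> above the threshold minus \<open>P\<close>. The
  latter also contains a nonempty open set \<open>J\<close> disjoint from \<open>S\<close>, so the measure of \<open>S\<close> absorbs a
  positive number and must be infinite.
\<close>

lemma emeasure_cos_gt_half: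
  fixes b \<phi> T :: real
  assumes "b \<noteq> 0"
  shows "emeasure lborel {t. T < t \<and> cos (b * t + \<phi>) > 1 / 2} = \<infinity>"
proof -
  define t0 where "t0 = - \<phi> / b"
  \<comment> \<open>A maximum of the cosine; the threshold is raised above it so that a long enough translation
    brings it into \<open>J\<close>.\<close>
  define T' where "T' = max T (t0 + 1)"
  define C where "C = {t. cos (b * t + \<phi>) > 1 / 2}"
  have "open C"
    unfolding C_def by (intro open_Collect_less continuous_intros)
  have t0C: "t0 \<in> C" using assms by (simp add: C_def t0_def)
  obtain n :: nat where n: "(T' - t0) * \<bar>b\<bar> / (2 * pi) < n"
    using reals_Archimedean2 by blast
  define P where "P = 2 * pi * n / \<bar>b\<bar>"
  have P: "T' - t0 < P"
    using n assms by (simp add: P_def field_simps)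
  have "P \<ge> 0" by (simp add: P_def)
  have per: "P + t \<in> C \<longleftrightarrow> t \<in> C" for t
  proof -
    have eq: "b * (P + t) + \<phi> = (b * t + \<phi>) + sgn b * (2 * pi * n)"
      using assms by (simp add: P_def sgn_if field_simps)
    have "cos (x + sgn b * (2 * pi * n)) = cos x" for x
      using assms cos_int_2pin[of "int n"] sin_int_2pin[of "int n"]
      by (auto simp: sgn_if cos_add cos_diff)
    then show ?thesis unfolding C_def mem_Collect_eq eq by simp
  qed
  define S J where "S = {T'<..} \<inter> C" and "J = {T' - P<..<T'} \<inter> C"
  have [measurable]: "C \<in> sets borel" using \<open>open C\<close> by auto
  have S [measurable]: "S \<in> sets borel" and J [measurable]: "J \<in> sets borel"
    by (auto simp: S_def J_def)
  have "emeasure lborel S + emeasure lborel J = emeasure lborel (S \<union> J)"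
    by (intro plus_emeasure) (auto simp: S_def J_def)
  also have "\<dots> \<le> emeasure lborel ((+) P -` S)"
    using \<open>P \<ge> 0\<close> measurable_sets[of "(+) P" borel borel S]
    by (intro emeasure_mono) (auto simp: S_def J_def per)
  also have "\<dots> = emeasure (distr lborel borel ((+) P)) S"
    by (simp add: emeasure_distr)
  also have "\<dots> = emeasure lborel S" by (simp add: lborel_distr_plus)
  finally have le: "emeasure lborel S + emeasure lborel J \<le> emeasure lborel S" .
  have "emeasure lborel J \<noteq> 0"
  proof
    assume "emeasure lborel J = 0"
    then have "J \<in> null_sets lborel" by (simp add: null_sets_def)
    then have "negligible J"
      by (simp add: negligible_iff_null_sets null_sets_completionI)
    moreover have "open J" using \<open>open C\<close> by (auto simp: J_def)
    moreover have "t0 \<in> J" using P t0C by (simp add: J_def T'_def)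
    ultimately show False using open_not_negligible by blast
  qed
  then have "emeasure lborel S = \<infinity>"
    using le by (cases "emeasure lborel S"; cases "emeasure lborel J")
      (auto simp: ennreal_plus[symmetric] top_unique simp del: ennreal_plus)
  moreover have "emeasure lborel S \<le> emeasure lborel {t. T < t \<and> cos (b * t + \<phi>) > 1 / 2}"
    by (rule emeasure_mono) (auto simp: S_def C_def T'_def)
  ultimately show ?thesis by (simp add: top_unique)
qed

text \<open>
  Here \<open>exp (s * t)\<close> spirals outwards. Whenever \<open>exp (s * t) * w\<close> points within an angle
  \<open>pi / 3\<close> of the positive real axis, the first summand grows doubly exponentially and
  beats the Gaussian factor, while the second stays bounded. So the integrand is eventually at
  least 1 on a set of times \<open>t\<close> that recurs periodically, and this set has infinite measure.
\<close>

lemma sq_integrand_not_integrable_pos: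
  assumes "Re s > 0" and "Im s \<noteq> 0" and "w \<noteq> 0"
  shows "\<not> set_integrable lborel {0..} (sq_integrand s w)"
proof
  assume int: "set_integrable lborel {0..} (sq_integrand s w)"
  define a b where "a = Re s" and "b = Im s"
  define v where "v = norm w / 2"
  define k where "k = sqrt (2 * pi)"
  have pos: "a > 0" "v > 0" "k > 0"
    using assms by (auto simp: a_def v_def k_def)
  \<comment> \<open>\<open>v = norm w / 2\<close> since the cosine exceeds 1/2 on the chosen sector; \<open>exp (2 * v)\<close> bounds the
    second summand.\<close>
  have "filterlim (\<lambda>t. exp (- (t\<^sup>2) / 2) / k * (exp (exp (a * t) * v) - exp (2 * v))) at_top at_top"
    using pos by real_asymp
  then have "eventually (\<lambda>t. exp (- (t\<^sup>2) / 2) / k * (exp (exp (a * t) * v) - exp (2 * v)) \<ge> 1) at_top"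
    unfolding filterlim_at_top by (rule spec)
  then obtain T where T:
    "\<And>t. t \<ge> T \<Longrightarrow> exp (- (t\<^sup>2) / 2) / k * (exp (exp (a * t) * v) - exp (2 * v)) \<ge> 1"
    by (auto simp: eventually_at_top_linorder)
  define S where "S = {t. max T 0 < t \<and> cos (b * t + Arg w) > 1 / 2}"
  have "open S"
    unfolding S_def Collect_conj_eq by (intro open_Int open_Collect_less continuous_intros)
  then have [measurable]: "S \<in> sets borel" by auto
  have large: "norm (sq_integrand s w t) \<ge> 1" if t: "t \<in> S" for t
  proof -
    have t': "t \<ge> T" "t \<ge> 0" "cos (b * t + Arg w) > 1 / 2"
      using t by (auto simp: S_def)
    have "exp (s * of_real t) * w = rcis (exp (a * t)) (b * t) * rcis (norm w) (Arg w)"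
      by (simp only: rcis_cmod_Arg) (simp add: exp_eq_polar rcis_def a_def b_def)
    then have "Re (exp (s * of_real t) * w) = exp (a * t) * norm w * cos (b * t + Arg w)"
      by (simp add: rcis_mult)
    also have "\<dots> \<ge> exp (a * t) * norm w * (1 / 2)"
      using t' by (intro mult_left_mono) auto
    finally have "exp (exp (a * t) * v) \<le> norm (exp (exp (s * of_real t) * w))"
      by (simp add: v_def)
    moreover have "norm (exp (exp (- s * of_real t) * w)) \<le> exp (2 * v)"
    proof -
      have "Re (exp (- s * of_real t) * w) \<le> norm (exp (- s * of_real t)) * norm w"
        by (metis complex_Re_le_cmod norm_mult)
      also have "\<dots> \<le> 1 * norm w"
        using t' pos by (intro mult_right_mono) (auto simp: a_def)
      finally show ?thesis by (simp add: v_def)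
    qed
    ultimately have "exp (exp (a * t) * v) - exp (2 * v) \<le>
        norm (exp (exp (s * of_real t) * w) + exp (exp (- s * of_real t) * w))"
      using norm_diff_ineq[of "exp (exp (s * of_real t) * w)" "exp (exp (- s * of_real t) * w)"]
      by linarith
    then have "exp (- (t\<^sup>2) / 2) / k * (exp (exp (a * t) * v) - exp (2 * v)) \<le>
        norm (sq_integrand s w t)"
      unfolding sq_integrand_def norm_mult norm_gauss_weight std_normal_density_def
      using pos by (simp add: k_def divide_right_mono)
    then show ?thesis using T[OF t'(1)] by linarith
  qed
  have "integrable lborel (indicator S :: real \<Rightarrow> real)"
  proof (rule Bochner_Integration.integrable_bound)
    show "integrable lborel (\<lambda>t. indicator {0..} t *\<^sub>R sq_integrand s w t)"
      using int by (simp add: set_integrable_def)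
    show "AE t in lborel. norm (indicator S t :: real) \<le> norm (indicator {0..} t *\<^sub>R sq_integrand s w t)"
      using large by (intro AE_I2) (auto simp: indicator_def S_def)
  qed simp
  then have "emeasure lborel S < \<infinity>"
    by (simp add: integrable_indicator_iff)
  then show False
    using emeasure_cos_gt_half[of b "max T 0" "Arg w"] assms by (simp add: S_def b_def)
qed

lemma sq_integrand_integrable_imp:
  assumes "set_integrable lborel {0..} (sq_integrand s w)"
  shows "w = 0 \<or> Re s = 0 \<or> Im s = 0"
proof (rule ccontr)
  assume neg: "\<not> ?thesis"
  have "sq_integrand (- s) w = sq_integrand s w"
    by (simp add: sq_integrand_def fun_eq_iff add.commute)
  then show False
    using assms neg sq_integrand_not_integrable_pos[of s w] sq_integrand_not_integrable_pos[of "- s" w]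
    by (cases "Re s > 0") auto
qed

section \<open>Equality wherever both sides converge\<close>

text \<open>
  The two convergence hypotheses leave only the case covered by termwise integration:
  \<open>(Re s)\<^sup>2 \<le> (Im s)\<^sup>2\<close> from the series, and a vanishing real or imaginary part from the integral,
  together give \<open>Re s = 0\<close> unless \<open>w = 0\<close>.
\<close>

lemma sq_integral_eq_if_convergent:
  assumes "summable (\<lambda>n. exp (s\<^sup>2 / 2) ^ (n\<^sup>2) * w ^ n / fact n)"
    and "set_integrable lborel {0..} (sq_integrand s w)"
  shows "(\<Sum>n. exp (s\<^sup>2 / 2) ^ (n\<^sup>2) * w ^ n / fact n) = (LBINT t:{0..}. sq_integrand s w t)"
proof -
  have "w = 0 \<or> Re s = 0"
  proof (rule ccontr)
    assume *: "\<not> ?thesis"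
    then have "(Re s)\<^sup>2 - (Im s)\<^sup>2 \<le> 0"
      using norm_le_1_if_summable_square_powers[OF assms(1)] by (simp add: power2_eq_square)
    moreover have "Im s = 0"
      using sq_integrand_integrable_imp[OF assms(2)] * by blast
    ultimately show False using * by simp
  qed
  from sq_integrand_termwise(2)[OF this] show ?thesis
    by (rule sums_unique [symmetric])
qed

section \<open>The two families as one\<close>

lemma choose_two_power:
  fixes p r :: complex
  assumes "p \<noteq> 0"
  shows "p ^ (n\<^sup>2) * (r / p) ^ n = (p\<^sup>2) ^ (n choose 2) * r ^ n"
proof -
  have "n\<^sup>2 = 2 * (n choose 2) + n"
    by (cases n) (auto simp: choose_two power2_eq_square)
  then show ?thesis
    using assms by (simp add: power_add power_mult power_divide)
qed

lemma Re_eq_0_if_square_nonpos: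
  fixes s :: complex
  assumes "Im (s\<^sup>2) = 0" and "Re (s\<^sup>2) \<le> 0"
  shows "Re s = 0"
  using assms by (auto simp: power2_eq_square mult_le_0_iff)

theorem proposition5p2:
  fixes q r z s u :: complex
  assumes "q \<noteq> 0"
    and "s\<^sup>2 = 2 * Ln q"
    and "u\<^sup>2 = Ln q"
  shows
    "has_termwise_integral (sq_integrand_fps s r) (E_sq_fps q r) {0..} \<and>
     has_termwise_integral (sq_integrand_fps u (r / exp (Ln q / 2))) (E_sq_tilde_fps q r) {0..} \<and>
     (summable (\<lambda>n. q ^ (n\<^sup>2) * r ^ n * (z ^ n / fact n)) \<and>
      set_integrable lborel {0..} (sq_integrand s (r * z)) \<longrightarrow>
        E_sq q r z = (LBINT t:{0..}. sq_integrand s (r * z) t)) \<and>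
     (summable (\<lambda>n. q ^ (n choose 2) * r ^ n * (z ^ n / fact n)) \<and>
      set_integrable lborel {0..} (sq_integrand u (r * z / exp (Ln q / 2))) \<longrightarrow>
        E_sq_tilde q r z = (LBINT t:{0..}. sq_integrand u (r * z / exp (Ln q / 2)) t)) \<and>
     (q \<in> complex_of_real ` {0<..1} \<longrightarrow>
        summable (\<lambda>n. q ^ (n\<^sup>2) * r ^ n * (z ^ n / fact n)) \<and>
        set_integrable lborel {0..} (sq_integrand s (r * z)) \<and>
        summable (\<lambda>n. q ^ (n choose 2) * r ^ n * (z ^ n / fact n)) \<and>
        set_integrable lborel {0..} (sq_integrand u (r * z / exp (Ln q / 2))))"
proof -
  define p where "p = exp (Ln q / 2)"
  have p: "p \<noteq> 0" "p\<^sup>2 = q"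
    using assms(1) by (simp_all add: p_def exp_double [symmetric])
  have es: "exp (s\<^sup>2 / 2) = q" and eu: "exp (u\<^sup>2 / 2) = p"
    using assms by (simp_all add: p_def)
  have coeff: "p ^ (n\<^sup>2) * (c / p) ^ n = q ^ (n choose 2) * c ^ n" for n c
    using choose_two_power[OF p(1), of n c] p(2) by simp
  have fps: "E_sq_fps q r = Abs_fps (\<lambda>n. exp (s\<^sup>2 / 2) ^ (n\<^sup>2) * r ^ n / fact n)"
    "E_sq_tilde_fps q r = Abs_fps (\<lambda>n. exp (u\<^sup>2 / 2) ^ (n\<^sup>2) * (r / p) ^ n / fact n)"
    by (simp_all add: E_sq_fps_def E_sq_tilde_fps_def es eu coeff)
  have terms: "q ^ (n\<^sup>2) * r ^ n * (z ^ n / fact n)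
        = exp (s\<^sup>2 / 2) ^ (n\<^sup>2) * (r * z) ^ n / fact n"
    "q ^ (n choose 2) * r ^ n * (z ^ n / fact n)
        = exp (u\<^sup>2 / 2) ^ (n\<^sup>2) * (r * z / p) ^ n / fact n" for n
    by (simp_all only: es eu coeff) (simp_all add: power_mult_distrib)
  have imaginary: "Re s = 0" "Re u = 0" if "q \<in> complex_of_real ` {0<..1}"
  proof -
    from that obtain x where x: "q = of_real x" "0 < x" "x \<le> 1" by auto
    then have "Ln q = of_real (ln x)" by (simp add: Ln_of_real)
    then show "Re s = 0" "Re u = 0"
      using x assms by (auto intro!: Re_eq_0_if_square_nonpos)
  qed
  have converges: "summable (\<lambda>n. exp (v\<^sup>2 / 2) ^ (n\<^sup>2) * w ^ n / fact n)"
    "set_integrable lborel {0..} (sq_integrand v w)" if "Re v = 0" for v w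
    using that sq_integrand_termwise[of w v] by (auto dest: sums_summable)
  show ?thesis
    unfolding E_sq_def E_sq_tilde_def p_def [symmetric] fps terms
    by (intro conjI impI;
        (rule has_termwise_integral_sq_integrand_fps
        | (elim conjE, rule sq_integral_eq_if_convergent; assumption)
        | (rule converges, rule imaginary, assumption)))
qed

end
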